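(* Let $n\ge1$, fix a monomial order on the monomials in $X_1,\dots,X_n$, and let $P\subseteq\mathbb R^n$ be a bounded convex set of positive volume. For any $0<\varepsilon\le1$, there is a number $D>0$ such that for all real numbers $d>D$, we have \[ (1-\varepsilon)d\cdot S_P\cap\mathbb N^n\subseteq E_{d\cdot P\cap\mathbb Z^n}\subseteq d\cdot S_P\cap\mathbb N^n . \]
   Context: $\mathbb N$ is the set of nonnegative integers. A monomial order is a total well-order on the monomials $X^e=X_1^{e_1}\cdots X_n^{e_n}$ ($e\in\mathbb N^n$) compatible with multiplication; the leading monomial of a nonzero polynomial is its largest monomial. For a real number $d$ and $A\subseteq\mathbb R^n$, $d\cdot A=\{da\mid a\in A\}$; scaling binds tighter than intersection, so $d\cdot P\cap\mathbb Z^n=(d\cdot P)\cap\mathbb Z^n$. For finite $A\subseteq\mathbb R^n$, let $E_A$ be the set of $e\in\mathbb N^n$ such that $X^e$ is not the leading monomial of any nonzero polynomial in $\mathbb R[X_1,\dots,X_n]$ vanishing on $A$. For a bounded convex set $P\subseteq\mathbb R^n$, the sets $2^{-k}\cdot E_{2^k\cdot P\cap\mathbb Z^n}$ ($k\ge0$) form an ascending chain, and \[ S_P=\overline{\bigcup_{k\ge0}2^{-k}\cdot E_{2^k\cdot P\cap\mathbb Z^n}}\subseteq\mathbb R_{\ge0}^n \] is the closure of their union. *)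

theory Defs
  imports "HOL-Analysis.Analysis" "HOL-Library.Poly_Mapping"
begin

text \<open>
  The variables are indexed by a finite type \<open>'n\<close>, so \<open>n = CARD('n) \<ge> 1\<close>. A monomial \<open>X^e\<close> is
  represented by its exponent vector \<open>e\<close>, and the product of monomials is addition of exponents.
\<close>

type_synonym 'n exponent = "nat ^ 'n"
type_synonym 'n real_poly = "'n exponent \<Rightarrow>\<^sub>0 real"

definition eval_poly :: "'n::finite real_poly \<Rightarrow> real ^ 'n \<Rightarrow> real" where
  "eval_poly p x = (\<Sum>e\<in>Poly_Mapping.keys p. Poly_Mapping.lookup p e * (\<Prod>i\<in>UNIV. (x $ i) ^ (e $ i)))"

text \<open>\<open>(a, b) \<in> r\<close> reads \<open>X^a \<le> X^b\<close>.\<close>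

definition monomial_order :: "'n::finite exponent rel \<Rightarrow> bool" where
  "monomial_order r \<longleftrightarrow>
     well_order_on UNIV r \<and> (\<forall>a b c. (a, b) \<in> r \<longrightarrow> (a + c, b + c) \<in> r)"

definition leading_exponent :: "'n::finite exponent rel \<Rightarrow> 'n real_poly \<Rightarrow> 'n exponent" where
  "leading_exponent r p = (THE e. e \<in> Poly_Mapping.keys p \<and> (\<forall>e'\<in>Poly_Mapping.keys p. (e', e) \<in> r))"

lemma leading_exponent_unique:
  assumes "monomial_order r" and "p \<noteq> 0"
  shows "\<exists>!e. e \<in> Poly_Mapping.keys p \<and> (\<forall>e'\<in>Poly_Mapping.keys p. (e', e) \<in> r)"
proof -
  have lin: "refl r" "trans r" "antisym r" "total r"
    using assms(1)
    by (auto simp: monomial_order_def well_order_on_def linear_order_on_def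
        partial_order_on_def preorder_on_def)
  have "\<exists>e\<in>A. \<forall>e'\<in>A. (e', e) \<in> r" if "finite A" "A \<noteq> {}" for A
    using that
  proof (induction rule: finite_ne_induct)
    case (singleton x)
    then show ?case using lin(1) by (auto dest: reflD)
  next
    case (insert x F)
    then obtain e where e: "e \<in> F" "\<forall>e'\<in>F. (e', e) \<in> r" by blast
    have "x = e \<or> (x, e) \<in> r \<or> (e, x) \<in> r" using lin(4) by (auto simp: total_on_def)
    moreover have "(x, x) \<in> r" using lin(1) by (rule reflD)
    ultimately show ?case using e lin(2) by (blast dest: transD)
  qed
  moreover have "finite (Poly_Mapping.keys p)" "Poly_Mapping.keys p \<noteq> {}" using assms(2) by auto
  ultimately show ?thesis using lin(3) by (meson antisymD)
qed

definition nat_lattice :: "(real ^ 'n::finite) set" where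
  "nat_lattice = {x. \<forall>i. x $ i \<in> \<nat>}"

definition int_lattice :: "(real ^ 'n::finite) set" where
  "int_lattice = {x. \<forall>i. x $ i \<in> \<int>}"

text \<open>\<open>E\<^sub>A\<close>, with exponent vectors viewed as points of \<open>\<nat>^n \<subseteq> \<real>^n\<close>.\<close>

definition nonleading_exponents ::
    "'n::finite exponent rel \<Rightarrow> (real ^ 'n) set \<Rightarrow> (real ^ 'n) set" where
  "nonleading_exponents r A =
     (\<lambda>e. \<chi> i. real (e $ i)) `
       {e. \<not> (\<exists>p. p \<noteq> 0 \<and> (\<forall>a\<in>A. eval_poly p a = 0) \<and> leading_exponent r p = e)}"

definition limit_shape ::
    "'n::finite exponent rel \<Rightarrow> (real ^ 'n) set \<Rightarrow> (real ^ 'n) set" where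
  "limit_shape r P =
     closure (\<Union>k::nat. (*\<^sub>R) (1 / 2 ^ k) `
       nonleading_exponents r ((*\<^sub>R) (2 ^ k) ` P \<inter> int_lattice))"

end

theory Submission
  imports Defs
begin

text \<open>
  By duality, \<open>e \<in> E\<^sub>A\<close> for finite \<open>A\<close> iff some linear combination of evaluations at points of
  \<open>A\<close> kills \<open>X^f\<close> for all \<open>f < e\<close> but not \<open>X^e\<close>. Convolving two such functionals gives
  \<open>E\<^sub>A + E\<^sub>B \<subseteq> E\<^bsub>A + B\<^esub>\<close>, so the sets belonging to the dilates \<open>s\<cdot>P\<close> are superadditive in \<open>s\<close>.
  As \<open>P\<close> has an interior point, \<open>s\<cdot>P\<close> contains an integer cube of side proportional to \<open>s\<close>, and
  its set contains \<open>(M, \<dots>, M)\<close> with \<open>M \<ge> c s\<close>. For the upper inclusion, \<open>j e\<close> lies in the set of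
  \<open>2^k\<cdot>P\<close> whenever \<open>2^k - j d\<close> is nonnegative and large enough, and \<open>j / 2^k\<close> can tend to \<open>1 / d\<close>. For the lower one,
  approximate \<open>S\<^sub>P\<close> by its \<open>k\<close>-th stage up to \<open>\<eta>\<close> (compactness), fill up \<open>(1 - \<epsilon>) d\<close> with
  copies of \<open>2^k\<cdot>P\<close>, and let the cube in the remaining dilate by about \<open>\<epsilon> d\<close> absorb the error.
\<close>

section \<open>Exponents, monomials and evaluation\<close>

text \<open>Exponents of the standard monomials of the vanishing ideal of \<open>A\<close>, kept as
  natural vectors so that \<open>r\<close> and addition act on them directly;
  \<open>real_vec\<close> embeds them into real space.\<close>

definition std_exps :: "'n::finite exponent rel \<Rightarrow> (real ^ 'n) set \<Rightarrow> 'n exponent set" where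
  "std_exps r A = {e. \<not> (\<exists>p. p \<noteq> 0 \<and> (\<forall>a\<in>A. eval_poly p a = 0) \<and> leading_exponent r p = e)}"

definition real_vec :: "'n::finite exponent \<Rightarrow> real ^ 'n" where
  "real_vec e = (\<chi> i. real (e $ i))"

definition monom_at :: "'n::finite exponent \<Rightarrow> real ^ 'n \<Rightarrow> real" where
  "monom_at e x = (\<Prod>i\<in>UNIV. (x $ i) ^ (e $ i))"

abbreviation unit_exp :: "'n \<Rightarrow> 'n::finite exponent" where
  "unit_exp i \<equiv> (\<chi> j. of_bool (j = i))"

lemma nonleading_exponents_eq: "nonleading_exponents r A = real_vec ` std_exps r A"
  by (simp add: nonleading_exponents_def std_exps_def real_vec_def[abs_def])

lemma real_vec_nth [simp]: "real_vec e $ i = real (e $ i)"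
  by (simp add: real_vec_def)

lemma monom_at_add: "monom_at (e + f) x = monom_at e x * monom_at f x"
  by (simp add: monom_at_def power_add prod.distrib)

text \<open>Functions rather than vectors, the form in which \<open>prod_sum_PiE\<close> expands a
  product of sums.\<close>

definition subexps :: "'n::finite exponent \<Rightarrow> ('n \<Rightarrow> nat) set" where
  "subexps g = PiE UNIV (\<lambda>i. {..g $ i})"

text \<open>The multivariate binomial theorem: expand each coordinate separately, then multiply
  out.\<close>

lemma monom_at_sum:
  fixes a b :: "real ^ 'n::finite"
  shows "monom_at g (a + b) = (\<Sum>k\<in>subexps g. (\<Prod>i\<in>UNIV. real (g $ i choose k i)) *
      (monom_at (\<chi> i. k i) a * monom_at (\<chi> i. g $ i - k i) b))"
proof -
  have "monom_at g (a + b)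
      = (\<Prod>i\<in>UNIV. \<Sum>k\<le>g $ i. real (g $ i choose k) * a $ i ^ k * b $ i ^ (g $ i - k))"
    by (simp add: monom_at_def binomial_ring)
  also have "\<dots> = (\<Sum>k\<in>subexps g. \<Prod>i\<in>UNIV. real (g $ i choose k i) * a $ i ^ k i * b $ i ^ (g $ i - k i))"
    unfolding subexps_def by (rule prod_sum_PiE) auto
  finally show ?thesis by (simp add: monom_at_def prod.distrib mult.assoc)
qed

lemma finite_subexps: "finite (subexps g)"
  unfolding subexps_def by (rule finite_PiE) auto

lemma eval_poly_superset:
  assumes "finite K" "Poly_Mapping.keys p \<subseteq> K"
  shows "eval_poly p x = (\<Sum>e\<in>K. Poly_Mapping.lookup p e * monom_at e x)"
  unfolding eval_poly_def monom_at_def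
  by (rule sum.mono_neutral_left) (use assms in \<open>auto simp: in_keys_iff\<close>)

text \<open>Closes the polynomial functions with prescribed exponents under linear combinations; the
  coefficient formula serves to identify a leading term.\<close>

lemma eval_poly_linear_combination:
  fixes p q :: "'n::finite real_poly"
  obtains s where "Poly_Mapping.keys s \<subseteq> Poly_Mapping.keys p \<union> Poly_Mapping.keys q"
    and "\<And>x. eval_poly s x = a * eval_poly p x + b * eval_poly q x"
    and "\<And>e. Poly_Mapping.lookup s e = a * Poly_Mapping.lookup p e + b * Poly_Mapping.lookup q e"
proof -
  define s where "s = Poly_Mapping.map ((*) a) p + Poly_Mapping.map ((*) b) q"
  have l: "Poly_Mapping.lookup s e = a * Poly_Mapping.lookup p e + b * Poly_Mapping.lookup q e" for e
    by (simp add: s_def lookup_add Poly_Mapping.map.rep_eq when_def)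
  let ?K = "Poly_Mapping.keys p \<union> Poly_Mapping.keys q"
  have k: "Poly_Mapping.keys s \<subseteq> ?K"
    by (auto simp: in_keys_iff l)
  have "eval_poly s x = a * eval_poly p x + b * eval_poly q x" for x
    using k by (simp add: eval_poly_superset[of ?K] l sum_distrib_left sum.distrib algebra_simps)
  with k l that show ?thesis by blast
qed

lemma eval_poly_single: "eval_poly (Poly_Mapping.single e c) x = c * monom_at e x"
  by (simp add: eval_poly_superset[of "{e}"] )

section \<open>Separation by functionals in finite dimension\<close>

text \<open>Gaussian elimination, one point of \<open>A\<close> at a time. Members of
  \<open>V\<close> are functions on the whole type, but only their values on \<open>A\<close>
  count.\<close>

lemma separating_weights:
  fixes V :: "('a \<Rightarrow> real) set"
  assumes "finite A" and "V \<noteq> {}"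
    and "\<And>u v a b. u \<in> V \<Longrightarrow> v \<in> V \<Longrightarrow> (\<lambda>x. a * u x + b * v x) \<in> V"
    and "\<And>v. v \<in> V \<Longrightarrow> \<exists>x\<in>A. v x \<noteq> g x"
  obtains c where "\<And>v. v \<in> V \<Longrightarrow> (\<Sum>x\<in>A. c x * v x) = 0" and "(\<Sum>x\<in>A. c x * g x) \<noteq> 0"
proof -
  have "\<exists>c. (\<forall>v\<in>V. (\<Sum>x\<in>A. c x * v x) = 0) \<and> (\<Sum>x\<in>A. c x * g x) \<noteq> 0"
    using assms
  proof (induction A arbitrary: V g rule: finite_induct)
    case empty
    then show ?case by blast
  next
    case (insert y A)
    note lin = insert.prems(2)
    show ?case
    proof (cases "\<exists>v\<in>V. v y \<noteq> 0")
      case True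
      then obtain w where w: "w \<in> V" "w y \<noteq> 0" by blast
      \<comment> \<open>Both constructions make the coordinate \<open>y\<close> vanish:
        \<open>g'\<close> is \<open>g\<close> projected along the pivot \<open>w\<close>, and
        \<open>V'\<close> is the part of \<open>V\<close> that is zero at \<open>y\<close>.\<close>
      define g' where "g' = (\<lambda>x. g x - g y / w y * w x)"
      define V' where "V' = {v \<in> V. v y = 0}"
      have "(\<lambda>x. 0 * w x + 0 * w x) \<in> V" using lin w(1) by blast
      then have "V' \<noteq> {}" by (auto simp: V'_def)
      moreover have "(\<lambda>x. a * u x + b * v x) \<in> V'" if "u \<in> V'" "v \<in> V'" for u v a b
        using that lin by (auto simp: V'_def)
      moreover have "\<exists>x\<in>A. v x \<noteq> g' x" if "v \<in> V'" for v
      proof (rule ccontr)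
        assume "\<not> ?thesis"
        then have eq: "v x = g' x" if "x \<in> insert y A" for x
          using that \<open>v \<in> V'\<close> w(2) by (auto simp: V'_def g'_def)
        \<comment> \<open>Undoing the projection: \<open>v\<close> plus this multiple of
          \<open>w\<close> would agree with \<open>g\<close> on all of
          \<open>insert y A\<close>.\<close>
        have "(\<lambda>x. 1 * v x + g y / w y * w x) \<in> V"
          using lin[of v w 1 "g y / w y"] that w(1) by (simp add: V'_def)
        then obtain x where "x \<in> insert y A" "1 * v x + g y / w y * w x \<noteq> g x"
          using insert.prems(3) by blast
        then show False using eq by (auto simp: g'_def)
      qed
      ultimately obtain c where c: "\<And>v. v \<in> V' \<Longrightarrow> (\<Sum>x\<in>A. c x * v x) = 0"
          "(\<Sum>x\<in>A. c x * g' x) \<noteq> 0"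
        using insert.IH[of V' g'] by blast
      \<comment> \<open>The weight at \<open>y\<close> is the one for which the functional
        annihilates \<open>w\<close>.\<close>
      define c' where "c' = c(y := - (\<Sum>x\<in>A. c x * w x) / w y)"
      have c': "(\<Sum>x\<in>insert y A. c' x * v x) = c' y * v y + (\<Sum>x\<in>A. c x * v x)" for v
        using insert.hyps by (auto simp: c'_def intro!: sum.cong)
      have cw: "(\<Sum>x\<in>insert y A. c' x * w x) = 0"
        using w(2) by (simp only: c') (simp add: c'_def)
      \<comment> \<open>As the functional annihilates \<open>w\<close>, it takes the same value at
        \<open>v\<close> and at the projection of \<open>v\<close> along \<open>w\<close>, which is
        zero at \<open>y\<close>, so that only the weights on \<open>A\<close> remain.\<close>
      have shift: "(\<Sum>x\<in>insert y A. c' x * v x) = (\<Sum>x\<in>A. c x * (v x - v y / w y * w x))" for v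
      proof -
        have "(\<Sum>x\<in>insert y A. c' x * v x)
            = (\<Sum>x\<in>insert y A. c' x * (v x - v y / w y * w x)) + v y / w y * (\<Sum>x\<in>insert y A. c' x * w x)"
          by (simp add: sum_distrib_left sum.distrib[symmetric] algebra_simps del: sum.insert)
        also have "\<dots> = (\<Sum>x\<in>A. c x * (v x - v y / w y * w x))"
          unfolding cw using w(2) by (simp only: c') simp
        finally show ?thesis .
      qed
      have "(\<Sum>x\<in>insert y A. c' x * v x) = 0" if "v \<in> V" for v
      proof -
        have "(\<lambda>x. 1 * v x + - (v y / w y) * w x) \<in> V" using lin that w(1) by blast
        then have "(\<lambda>x. v x - v y / w y * w x) \<in> V'" using w(2) by (simp add: V'_def)
        then show ?thesis unfolding shift using c(1) by fastforce
      qed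
      moreover have "(\<Sum>x\<in>insert y A. c' x * g x) \<noteq> 0"
        unfolding shift using c(2) by (simp add: g'_def)
      ultimately show ?thesis by blast
    next
      case False
      show ?thesis
      proof (cases "g y = 0")
        case True
        then have "\<exists>x\<in>A. v x \<noteq> g x" if "v \<in> V" for v
          using False that insert.prems(3) by fastforce
        then obtain c where c: "\<And>v. v \<in> V \<Longrightarrow> (\<Sum>x\<in>A. c x * v x) = 0" "(\<Sum>x\<in>A. c x * g x) \<noteq> 0"
          using insert.IH[of V g] insert.prems by blast
        have "\<forall>v\<in>V. (\<Sum>x\<in>insert y A. c x * v x) = 0"
          using insert.hyps c(1) False by simp
        moreover have "(\<Sum>x\<in>insert y A. c x * g x) \<noteq> 0"
          using insert.hyps c(2) True by simp
        ultimately show ?thesis by blast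
      next
        case g: False
        have "(\<Sum>x\<in>insert y A. of_bool (x = y) * v x) = v y" for v :: "'a \<Rightarrow> real"
        proof -
          have "(\<Sum>x\<in>A. of_bool (x = y) * v x) = 0"
            using insert.hyps by (intro sum.neutral) auto
          then show ?thesis using insert.hyps by simp
        qed
        then show ?thesis using g False
          by (intro exI[of _ "\<lambda>x. of_bool (x = y)"]) simp
      qed
    qed
  qed
  then show ?thesis using that by blast
qed

section \<open>Monomial orders and the dual description of standard exponents\<close>

locale monomial_ordering =
  fixes r :: "'n::finite exponent rel"
  assumes mo: "monomial_order r"
begin

lemma ord_refl: "(a, a) \<in> r"
  using mo by (auto simp: monomial_order_def well_order_on_def linear_order_on_def
      partial_order_on_def preorder_on_def refl_on_def)

lemma ord_trans: "(a, b) \<in> r \<Longrightarrow> (b, c) \<in> r \<Longrightarrow> (a, c) \<in> r"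
  using mo by (auto simp: monomial_order_def well_order_on_def linear_order_on_def
      partial_order_on_def preorder_on_def dest: transD)

lemma ord_antisym: "(a, b) \<in> r \<Longrightarrow> (b, a) \<in> r \<Longrightarrow> a = b"
  using mo by (auto simp: monomial_order_def well_order_on_def linear_order_on_def
      partial_order_on_def preorder_on_def dest: antisymD)

lemma ord_total: "(a, b) \<in> r \<or> (b, a) \<in> r"
  using mo ord_refl[of a] by (cases "a = b") (auto simp: monomial_order_def well_order_on_def
      linear_order_on_def total_on_def)

lemma ord_add: "(a, b) \<in> r \<Longrightarrow> (a + c, b + c) \<in> r"
  using mo by (auto simp: monomial_order_def)

lemma ord_add_left: "(a, b) \<in> r \<Longrightarrow> (c + a, c + b) \<in> r"
  using ord_add[of a b c] by (simp add: add.commute)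

text \<open>If \<open>a\<close> were strictly below \<open>0\<close>, then
  \<open>0, a, 2a, ...\<close> would descend forever.\<close>

lemma ord_zero: "(0, a) \<in> r"
proof (rule ccontr)
  assume "(0, a) \<notin> r"
  then have lt: "(a, 0) \<in> r" "a \<noteq> 0" using ord_total ord_refl by metis+
  have "wf (r - Id)" using mo by (simp add: monomial_order_def well_order_on_def)
  moreover define s where "s n = (\<chi> i. n * a $ i)" for n :: nat
  have "(s (Suc n), s n) \<in> r - Id" for n
  proof -
    have "s (Suc n) = a + s n" by (simp add: s_def vec_eq_iff)
    then show ?thesis using ord_add[OF lt(1), of "s n"] lt(2) by simp
  qed
  ultimately show False by (auto simp: wf_iff_no_infinite_down_chain)
qed

lemma ord_mono: "(\<And>i. a $ i \<le> b $ i) \<Longrightarrow> (a, b) \<in> r"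
proof -
  assume le: "\<And>i. a $ i \<le> b $ i"
  define c where "c = (\<chi> i. b $ i - a $ i)"
  have "b = c + a" using le by (simp add: c_def vec_eq_iff)
  then show ?thesis using ord_add[OF ord_zero[of c], of a] by simp
qed

text \<open>A polynomial vanishing on \<open>A\<close> is killed by the functional, but if its
  leading exponent were \<open>e\<close>, exactly the leading term would survive. The points are
  indexed by \<open>I\<close> so that they may repeat, as sums \<open>a + b\<close> do in a
  convolution.\<close>

lemma std_expsI:
  fixes pt :: "'i \<Rightarrow> real ^ 'n"
  assumes "finite I" and "\<And>i. i \<in> I \<Longrightarrow> pt i \<in> A"
    and nz: "(\<Sum>i\<in>I. c i * monom_at e (pt i)) \<noteq> 0"
    and z: "\<And>f. (f, e) \<in> r \<Longrightarrow> f \<noteq> e \<Longrightarrow> (\<Sum>i\<in>I. c i * monom_at f (pt i)) = 0"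
  shows "e \<in> std_exps r A"
  unfolding std_exps_def
proof (safe)
  fix p :: "'n real_poly"
  assume p: "p \<noteq> 0" "\<forall>a\<in>A. eval_poly p a = 0" and e: "e = leading_exponent r p"
  let ?K = "Poly_Mapping.keys p"
  have lead: "e \<in> ?K" "\<And>f. f \<in> ?K \<Longrightarrow> (f, e) \<in> r"
    using theI'[OF leading_exponent_unique[OF mo p(1)]] unfolding e leading_exponent_def by blast+
  have "0 = (\<Sum>i\<in>I. c i * eval_poly p (pt i))"
    using p(2) assms(2) by simp
  also have "\<dots> = (\<Sum>f\<in>?K. Poly_Mapping.lookup p f * (\<Sum>i\<in>I. c i * monom_at f (pt i)))"
    unfolding eval_poly_superset[OF finite_keys subset_refl] sum_distrib_left
    by (subst sum.swap) (simp add: algebra_simps)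
  also have "\<dots> = (\<Sum>f\<in>{e}. Poly_Mapping.lookup p f * (\<Sum>i\<in>I. c i * monom_at f (pt i)))"
    by (rule sum.mono_neutral_right) (use lead z in auto)
  finally show False using nz lead(1) by (simp add: in_keys_iff)
qed

text \<open>On \<open>A\<close>, the monomial \<open>X^e\<close> is no combination of lower ones,
  since the difference would be a vanishing polynomial with leading exponent \<open>e\<close>. Hence
  some weights separate it from the span \<open>V\<close> of the lower monomials.\<close>

lemma std_expsE:
  assumes "finite A" and "e \<in> std_exps r A"
  obtains c where "(\<Sum>a\<in>A. c a * monom_at e a) \<noteq> 0"
    and "\<And>f. (f, e) \<in> r \<Longrightarrow> f \<noteq> e \<Longrightarrow> (\<Sum>a\<in>A. c a * monom_at f a) = 0"
proof -
  let ?F = "{f. (f, e) \<in> r \<and> f \<noteq> e}"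
  define V where "V = {eval_poly p | p. Poly_Mapping.keys p \<subseteq> ?F}"
  have "eval_poly 0 \<in> V" unfolding V_def by (intro CollectI exI[of _ 0]) simp
  then have "V \<noteq> {}" by blast
  moreover have "(\<lambda>x. a * u x + b * v x) \<in> V" if "u \<in> V" "v \<in> V" for u v a b
  proof -
    from that obtain p q where pq: "u = eval_poly p" "v = eval_poly q"
      "Poly_Mapping.keys p \<subseteq> ?F" "Poly_Mapping.keys q \<subseteq> ?F"
      by (auto simp: V_def)
    obtain s where s: "Poly_Mapping.keys s \<subseteq> Poly_Mapping.keys p \<union> Poly_Mapping.keys q"
      "\<And>x. eval_poly s x = a * eval_poly p x + b * eval_poly q x"
      by (metis eval_poly_linear_combination)
    have "(\<lambda>x. a * u x + b * v x) = eval_poly s" using s(2) pq by auto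
    moreover have "Poly_Mapping.keys s \<subseteq> ?F" using s(1) pq by blast
    ultimately show ?thesis unfolding V_def by blast
  qed
  moreover have "\<exists>x\<in>A. v x \<noteq> monom_at e x" if "v \<in> V" for v
  proof (rule ccontr)
    assume "\<not> ?thesis"
    moreover obtain p where p: "v = eval_poly p" "Poly_Mapping.keys p \<subseteq> ?F"
      using \<open>v \<in> V\<close> by (auto simp: V_def)
    ultimately have eq: "eval_poly p x = monom_at e x" if "x \<in> A" for x using that by blast
    obtain q where q: "Poly_Mapping.keys q \<subseteq> Poly_Mapping.keys (Poly_Mapping.single e (1::real)) \<union> Poly_Mapping.keys p"
      "\<And>x. eval_poly q x = 1 * eval_poly (Poly_Mapping.single e 1) x + (-1) * eval_poly p x"
      "\<And>f. Poly_Mapping.lookup q f = 1 * Poly_Mapping.lookup (Poly_Mapping.single e 1) f + (-1) * Poly_Mapping.lookup p f"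
      by (rule eval_poly_linear_combination[of "Poly_Mapping.single e 1" p 1 "-1"]) blast
    have "Poly_Mapping.lookup p e = 0" using p(2) by (auto simp: in_keys_iff)
    then have "Poly_Mapping.lookup q e = 1" using q(3)[of e] by simp
    then have eq_key: "e \<in> Poly_Mapping.keys q" and q0: "q \<noteq> 0" by (auto simp: in_keys_iff)
    have "(f, e) \<in> r" if "f \<in> Poly_Mapping.keys q" for f
      using that q(1) p(2) ord_refl by auto
    then have "leading_exponent r q = e"
      unfolding leading_exponent_def
      using eq_key by (intro the1_equality[OF leading_exponent_unique[OF mo q0]]) blast
    moreover have "\<forall>a\<in>A. eval_poly q a = 0"
      using q(2) eq by (simp add: eval_poly_single)
    ultimately show False using assms(2) q0 by (auto simp: std_exps_def)
  qed
  ultimately obtain c where c: "\<And>v. v \<in> V \<Longrightarrow> (\<Sum>x\<in>A. c x * v x) = 0"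
      "(\<Sum>x\<in>A. c x * monom_at e x) \<noteq> 0"
    using separating_weights[OF assms(1), of V "monom_at e"] by blast
  have "(\<Sum>a\<in>A. c a * monom_at f a) = 0" if "(f, e) \<in> r" "f \<noteq> e" for f
  proof -
    have "eval_poly (Poly_Mapping.single f 1) \<in> V"
      unfolding V_def using that by (intro CollectI exI[of _ "Poly_Mapping.single f 1"]) simp
    from c(1)[OF this] show ?thesis by (simp add: eval_poly_single)
  qed
  with c(2) that show ?thesis by blast
qed

text \<open>With \<open>e = f + g\<close>, multiplying the weights for \<open>e\<close> by the
  values of \<open>X^g\<close> gives a functional whose value at \<open>X^h\<close> is the old value
  at \<open>X^(h + g)\<close>.\<close>

lemma std_exps_downward:
  assumes "finite A" "e \<in> std_exps r A" "\<And>i. f $ i \<le> e $ i"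
  shows "f \<in> std_exps r A"
proof -
  define g where "g = (\<chi> i. e $ i - f $ i)"
  have e: "e = f + g" using assms(3) by (simp add: g_def vec_eq_iff)
  obtain c where c: "(\<Sum>a\<in>A. c a * monom_at e a) \<noteq> 0"
    "\<And>f. (f, e) \<in> r \<Longrightarrow> f \<noteq> e \<Longrightarrow> (\<Sum>a\<in>A. c a * monom_at f a) = 0"
    by (rule std_expsE[OF assms(1,2)]) blast
  show ?thesis
  proof (rule std_expsI[where I = A and pt = "\<lambda>a. a" and c = "\<lambda>a. c a * monom_at g a"])
    show "(\<Sum>a\<in>A. c a * monom_at g a * monom_at f a) \<noteq> 0"
      using c(1) by (simp add: e monom_at_add mult.assoc mult.commute[of "monom_at g _"])
    fix h assume "(h, f) \<in> r" "h \<noteq> f"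
    then have "(\<Sum>a\<in>A. c a * monom_at (h + g) a) = 0"
      by (intro c(2)) (auto simp: e intro: ord_add)
    then show "(\<Sum>a\<in>A. c a * monom_at g a * monom_at h a) = 0"
      by (simp add: monom_at_add mult.assoc mult.commute[of "monom_at g _"])
  qed (use assms in auto)
qed

section \<open>Standard exponents of sums of point sets and of boxes\<close>

text \<open>Convolve the two functionals by putting weight \<open>c a * d b\<close> at
  \<open>a + b\<close>. By the binomial theorem its value at \<open>X^g\<close> is a weighted sum of
  products of their values at \<open>X^f\<close> and \<open>X^h\<close> with
  \<open>f + h = g\<close>. A nonzero product forces \<open>f\<close> to be at least
  \<open>ea\<close> and \<open>h\<close> at least \<open>eb\<close>.\<close>

lemma std_exps_add:
  assumes "finite A" "finite B" and ea: "ea \<in> std_exps r A" and eb: "eb \<in> std_exps r B"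
    and "\<And>a b. a \<in> A \<Longrightarrow> b \<in> B \<Longrightarrow> a + b \<in> C"
  shows "ea + eb \<in> std_exps r C"
proof -
  obtain c where c: "(\<Sum>a\<in>A. c a * monom_at ea a) \<noteq> 0"
    "\<And>f. (f, ea) \<in> r \<Longrightarrow> f \<noteq> ea \<Longrightarrow> (\<Sum>a\<in>A. c a * monom_at f a) = 0"
    by (rule std_expsE[OF assms(1) ea]) blast
  obtain d where d: "(\<Sum>b\<in>B. d b * monom_at eb b) \<noteq> 0"
    "\<And>f. (f, eb) \<in> r \<Longrightarrow> f \<noteq> eb \<Longrightarrow> (\<Sum>b\<in>B. d b * monom_at f b) = 0"
    by (rule std_expsE[OF assms(2) eb]) blast
  let ?\<phi> = "\<lambda>f. \<Sum>a\<in>A. c a * monom_at f a" and ?\<psi> = "\<lambda>f. \<Sum>b\<in>B. d b * monom_at f b"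
  let ?w = "\<lambda>g k. \<Prod>i\<in>UNIV. real (g $ i choose k i)"
  let ?s = "\<lambda>z. case z of (a, b) \<Rightarrow> c a * d b" and ?p = "\<lambda>z. case z of (a, b) \<Rightarrow> a + b"
  have prod_sums: "(\<Sum>(a, b)\<in>A \<times> B. w * (x a * y b)) = w * (sum x A * sum y B)"
    for w :: real and x y
    by (simp only: sum_product) (simp only: sum.cartesian_product, simp add: sum_distrib_left case_prod_beta)
  have conv: "(\<Sum>z\<in>A \<times> B. ?s z * monom_at g (?p z))
      = (\<Sum>k\<in>subexps g. ?w g k * (?\<phi> (\<chi> i. k i) * ?\<psi> (\<chi> i. g $ i - k i)))" for g :: "'n exponent"
  proof -
    have "(\<Sum>z\<in>A \<times> B. ?s z * monom_at g (?p z)) = (\<Sum>(a, b)\<in>A \<times> B. \<Sum>k\<in>subexps g.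
        ?w g k * ((c a * monom_at (\<chi> i. k i) a) * (d b * monom_at (\<chi> i. g $ i - k i) b)))"
      by (intro sum.cong) (auto simp: monom_at_sum sum_distrib_left mult_ac)
    also have "\<dots> = (\<Sum>k\<in>subexps g. \<Sum>(a, b)\<in>A \<times> B.
        ?w g k * ((c a * monom_at (\<chi> i. k i) a) * (d b * monom_at (\<chi> i. g $ i - k i) b)))"
      unfolding case_prod_beta by (rule sum.swap)
    also have "\<dots> = (\<Sum>k\<in>subexps g. ?w g k * (?\<phi> (\<chi> i. k i) * ?\<psi> (\<chi> i. g $ i - k i)))"
      by (simp only: prod_sums)
    finally show ?thesis .
  qed
  have split: "(\<chi> i. k i) + (\<chi> i. g $ i - k i) = g" if "k \<in> subexps g" for k and g :: "'n exponent"
    using that by (auto simp: subexps_def vec_eq_iff PiE_iff)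
  \<comment> \<open>Compatibility of the order with addition makes the pair \<open>(ea, eb)\<close>
    the only one with sum \<open>ea + eb\<close> that can contribute.\<close>
  have key: "(ea + eb, f + h) \<in> r \<and> (f + h = ea + eb \<longrightarrow> f = ea)"
    if nz: "?\<phi> f * ?\<psi> h \<noteq> 0" for f h
  proof -
    have "(ea, f) \<in> r" using c(2)[of f] nz ord_total[of ea f] ord_refl by fastforce
    moreover have "(eb, h) \<in> r" using d(2)[of h] nz ord_total[of eb h] ord_refl by fastforce
    ultimately have "(ea + eb, f + eb) \<in> r" "(f + eb, f + h) \<in> r"
      using ord_add ord_add_left by blast+
    then show ?thesis using ord_trans ord_antisym by (metis add_right_cancel)
  qed
  show ?thesis
  proof (rule std_expsI[where I = "A \<times> B" and pt = ?p and c = ?s])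
    let ?g = "ea + eb" and ?k = "\<lambda>i. ea $ i"
    have k: "?k \<in> subexps ?g" by (auto simp: subexps_def)
    have "(\<Sum>k\<in>subexps ?g. ?w ?g k * (?\<phi> (\<chi> i. k i) * ?\<psi> (\<chi> i. ?g $ i - k i)))
       = (\<Sum>k\<in>{?k}. ?w ?g k * (?\<phi> (\<chi> i. k i) * ?\<psi> (\<chi> i. ?g $ i - k i)))"
    proof (rule sum.mono_neutral_right[OF finite_subexps])
      show "\<forall>k\<in>subexps ?g - {?k}. ?w ?g k * (?\<phi> (\<chi> i. k i) * ?\<psi> (\<chi> i. ?g $ i - k i)) = 0"
      proof (rule ballI, rule ccontr)
        fix k assume k: "k \<in> subexps ?g - {?k}"
          and nz: "?w ?g k * (?\<phi> (\<chi> i. k i) * ?\<psi> (\<chi> i. ?g $ i - k i)) \<noteq> 0"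
        have "(\<chi> i. k i) = ea" using key[of "\<chi> i. k i" "\<chi> i. ?g $ i - k i"] nz split[of k ?g] k
          by simp
        then have "k = ?k" by (auto simp: vec_eq_iff)
        then show False using k by simp
      qed
    qed (use k in simp)
    \<comment> \<open>Characteristic 0 enters: the binomial coefficient of the one surviving term is
      a nonzero real.\<close>
    moreover have "(\<Prod>i\<in>UNIV. real ((ea $ i + eb $ i) choose ea $ i)) \<noteq> 0"
      by simp
    ultimately show "(\<Sum>z\<in>A \<times> B. ?s z * monom_at ?g (?p z)) \<noteq> 0"
      unfolding conv using c(1) d(1) by simp
  next
    fix g assume g: "(g, ea + eb) \<in> r" "g \<noteq> ea + eb"
    show "(\<Sum>z\<in>A \<times> B. ?s z * monom_at g (?p z)) = 0"
      unfolding conv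
    proof (rule sum.neutral, rule ballI, rule ccontr)
      fix k assume k: "k \<in> subexps g"
        and nz: "?w g k * (?\<phi> (\<chi> i. k i) * ?\<psi> (\<chi> i. g $ i - k i)) \<noteq> 0"
      have "(ea + eb, g) \<in> r"
        using key[of "\<chi> i. k i" "\<chi> i. g $ i - k i"] nz split[OF k] by simp
      then show False using g ord_antisym by blast
    qed
  qed (use assms in auto)
qed

lemma zero_in_std_exps: "v \<in> A \<Longrightarrow> 0 \<in> std_exps r A"
  by (rule std_expsI[where I = "{v}" and pt = "\<lambda>a. a" and c = "\<lambda>_. 1"])
    (use ord_zero ord_antisym in \<open>auto simp: monom_at_def\<close>)


text \<open>The difference of the values at \<open>axis i 1\<close> and at \<open>0\<close> kills
  every monomial free of the variable \<open>X_i\<close>, and a monomial containing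
  \<open>X_i\<close> is at least \<open>X_i\<close>.\<close>

lemma unit_exp_in_std_exps: "unit_exp i \<in> std_exps r {0, axis i 1}"
proof (rule std_expsI[where I = "{0, axis i 1}" and pt = "\<lambda>a. a"
      and c = "\<lambda>a. if a = 0 then - 1 else 1"])
  have ax: "(axis i 1 :: real ^ 'n) \<noteq> 0" by (simp add: axis_eq_0_iff)
  have val: "(\<Sum>a\<in>{0, axis i 1}. (if a = 0 then - 1 else 1) * monom_at f a)
      = monom_at f (axis i 1) - monom_at f 0" for f
    using ax by simp
  show "(\<Sum>a\<in>{0, axis i 1}. (if a = 0 then - 1 else 1) * monom_at (unit_exp i) a) \<noteq> 0"
  proof -
    have "monom_at (unit_exp i) (axis i 1) = 1"
      unfolding monom_at_def by (intro prod.neutral) (auto simp: axis_def)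
    moreover have "monom_at (unit_exp i) 0 = 0"
      unfolding monom_at_def by (intro prod_zero bexI[of _ i]) auto
    ultimately show ?thesis unfolding val by simp
  qed
  fix f assume f: "(f, unit_exp i) \<in> r" "f \<noteq> unit_exp i"
  have "f $ i = 0"
  proof (rule ccontr)
    assume "f $ i \<noteq> 0"
    then have "(unit_exp i, f) \<in> r" by (intro ord_mono) auto
    then show False using f ord_antisym by blast
  qed
  then have "monom_at f (axis i 1) = monom_at f 0"
    unfolding monom_at_def by (intro prod.cong) (auto simp: axis_def)
  then show "(\<Sum>a\<in>{0, axis i 1}. (if a = 0 then - 1 else 1) * monom_at f a) = 0"
    unfolding val by simp
qed auto

text \<open>A lattice box is a sum of unit segments \<open>{0, axis i 1}\<close>, translated by
  \<open>v\<close>; each segment adds one \<open>unit_exp i\<close> to the exponent.\<close>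

lemma exponent_in_std_exps_of_box:
  assumes "finite A" and "\<And>f. (\<And>i. f $ i \<le> e $ i) \<Longrightarrow> v + real_vec f \<in> A"
  shows "e \<in> std_exps r A"
  using assms
proof (induction "\<Sum>i\<in>UNIV. e $ i" arbitrary: e A)
  case 0
  then have "e = 0" by (simp add: vec_eq_iff)
  moreover have "v + real_vec 0 \<in> A" using 0(3)[of 0] by simp
  ultimately show ?case using zero_in_std_exps by blast
next
  case (Suc n)
  then obtain i where i: "e $ i \<noteq> 0" by (metis Suc_neq_Zero sum.neutral)
  define g where "g = (\<chi> j. if j = i then e $ i - 1 else e $ j)"
  \<comment> \<open>The box shortened by one step in direction \<open>i\<close>; adding the segment
    in that direction restores the full box.\<close>
  define B where "B = (\<lambda>f. v + real_vec f) ` {f. \<forall>j. f $ j \<le> g $ j}"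
  have e: "e = g + unit_exp i" using i by (auto simp: g_def vec_eq_iff)
  have "(\<Sum>i\<in>UNIV. e $ i) = (\<Sum>i\<in>UNIV. g $ i) + 1"
    by (subst e) (simp add: sum.distrib of_bool_def)
  then have n: "n = (\<Sum>i\<in>UNIV. g $ i)" using Suc.hyps(2) by simp
  have "B \<subseteq> A" using Suc.prems(2) by (auto simp: B_def e intro: trans_le_add1)
  then have "finite B" using Suc.prems(1) finite_subset by blast
  have g: "g \<in> std_exps r B"
    by (rule Suc.hyps(1)[OF n \<open>finite B\<close>]) (auto simp: B_def)
  show ?case
    unfolding e
  proof (rule std_exps_add[OF \<open>finite B\<close> _ g unit_exp_in_std_exps])
    fix a b assume "a \<in> B" "b \<in> {0, axis i (1::real)}"
    then obtain f where f: "a = v + real_vec f" "\<And>j. f $ j \<le> g $ j" by (auto simp: B_def)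
    from \<open>b \<in> _\<close> consider "b = 0" | "b = axis i 1" by blast
    then show "a + b \<in> A"
    proof cases
      case 1
      then show ?thesis using \<open>B \<subseteq> A\<close> \<open>a \<in> B\<close> by auto
    next
      case 2
      have "a + b = v + real_vec (f + unit_exp i)"
        unfolding 2 f(1) by (auto simp: vec_eq_iff axis_def)
      also have "\<dots> \<in> A" using f(2) by (intro Suc.prems(2)) (simp add: e)
      finally show ?thesis .
    qed
  qed simp
qed

text \<open>
  On \<open>A\<close> the power \<open>X\<^sub>i^N\<close> with \<open>N = card T\<close> agrees with a combination of lower powers of \<open>X\<^sub>i\<close>.
\<close>

lemma std_exps_bounded_by_values:
  assumes "finite A" "finite T" "\<And>a. a \<in> A \<Longrightarrow> a $ i \<in> T" "e \<in> std_exps r A"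
  shows "e $ i < card T"
proof (rule ccontr)
  assume ge: "\<not> ?thesis"
  obtain c where c: "(\<Sum>a\<in>A. c a * monom_at e a) \<noteq> 0"
    "\<And>f. (f, e) \<in> r \<Longrightarrow> f \<noteq> e \<Longrightarrow> (\<Sum>a\<in>A. c a * monom_at f a) = 0"
    by (rule std_expsE[OF assms(1,4)]) blast
  \<comment> \<open>Monic of degree \<open>card T\<close> with roots \<open>T\<close>, so it
    vanishes at \<open>a $ i\<close> for every \<open>a\<close> in \<open>A\<close>.\<close>
  define q where "q = (\<Prod>t\<in>T. [:- t, 1:])"
  define N where "N = card T"
  have deg: "degree q = N" unfolding q_def N_def by (subst degree_prod_eq_sum_degree) auto
  have "lead_coeff q = 1" unfolding q_def by (simp add: lead_coeff_prod)
  then have lc: "coeff q N = 1" by (simp add: deg)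
  \<comment> \<open>\<open>h l\<close> replaces the factor \<open>X_i^N\<close> of
    \<open>X^e\<close> by \<open>X_i^l\<close>; the subtraction is exact since
    \<open>N \<le> e $ i\<close> is assumed for contradiction. So \<open>h N = e\<close>, and
    \<open>h l\<close> lies strictly below \<open>e\<close> for \<open>l < N\<close>.\<close>
  define h where "h l = (\<chi> j. if j = i then e $ i - N + l else e $ j)" for l
  have hN: "h N = e" using ge by (simp add: h_def N_def vec_eq_iff)
  have h: "monom_at (h l) a = monom_at (h 0) a * (a $ i) ^ l" for l a
  proof -
    have "h l = h 0 + (\<chi> j. if j = i then l else 0)" by (simp add: h_def vec_eq_iff)
    moreover have "monom_at (\<chi> j. if j = i then l else 0) a = (a $ i) ^ l"
      by (simp add: monom_at_def if_distrib[of "(^) _"] cong: if_cong)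
    ultimately show ?thesis by (metis monom_at_add)
  qed
  have hq: "monom_at (h 0) a * poly q (a $ i) = (\<Sum>l\<le>N. coeff q l * monom_at (h l) a)" for a
    unfolding poly_altdef deg sum_distrib_left by (intro sum.cong refl) (metis h mult.left_commute)
  have "0 = (\<Sum>a\<in>A. c a * (monom_at (h 0) a * poly q (a $ i)))"
    using assms(2,3) by (intro sum.neutral[symmetric]) (auto simp: q_def poly_prod)
  also have "\<dots> = (\<Sum>l\<le>N. coeff q l * (\<Sum>a\<in>A. c a * monom_at (h l) a))"
    unfolding hq sum_distrib_left by (subst sum.swap) (simp add: mult_ac)
  also have "\<dots> = (\<Sum>l\<in>{N}. coeff q l * (\<Sum>a\<in>A. c a * monom_at (h l) a))"
  proof (rule sum.mono_neutral_right)
    have "(\<Sum>a\<in>A. c a * monom_at (h l) a) = 0" if "l < N" for l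
    proof (rule c(2))
      show "(h l, e) \<in> r" using that ge by (intro ord_mono) (auto simp: h_def N_def)
      show "h l \<noteq> e" using that ge by (auto simp: h_def N_def vec_eq_iff)
    qed
    then show "\<forall>l\<in>{..N} - {N}. coeff q l * (\<Sum>a\<in>A. c a * monom_at (h l) a) = 0" by auto
  qed auto
  finally show False using c(1) by (simp add: hN lc)
qed

end

section \<open>Lattice points in real dilates of a convex body\<close>

lemma int_lattice_coord_bound:
  assumes "\<And>a. a \<in> A \<Longrightarrow> a \<in> int_lattice" and "\<And>a i. a \<in> A \<Longrightarrow> \<bar>a $ i\<bar> \<le> real K"
  shows "a \<in> A \<Longrightarrow> a $ i \<in> of_int ` {- int K..int K}"
proof -
  assume a: "a \<in> A"
  then have "a $ i \<in> \<int>" using assms(1) by (simp add: int_lattice_def)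
  then obtain z where z: "a $ i = of_int z" by (rule Ints_cases)
  then have "\<bar>real_of_int z\<bar> \<le> real K" using assms(2)[OF a, of i] by simp
  then have "z \<in> {- int K..int K}" by auto
  then show ?thesis using z by blast
qed

lemma finite_int_lattice_bounded:
  fixes A :: "(real ^ 'n::finite) set"
  assumes "\<And>a. a \<in> A \<Longrightarrow> a \<in> int_lattice" and "\<And>a i. a \<in> A \<Longrightarrow> \<bar>a $ i\<bar> \<le> real K"
  shows "finite A"
proof -
  let ?T = "of_int ` {- int K..int K} :: real set"
  have "A \<subseteq> (\<lambda>f. \<chi> i. f i) ` PiE UNIV (\<lambda>_. ?T)"
  proof
    fix a assume a: "a \<in> A"
    have "a = (\<chi> i. a $ i)" by simp
    moreover have "(\<lambda>i. a $ i) \<in> PiE UNIV (\<lambda>_. ?T)"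
      using int_lattice_coord_bound[OF assms a] by auto
    ultimately show "a \<in> (\<lambda>f. \<chi> i. f i) ` PiE UNIV (\<lambda>_. ?T)" by blast
  qed
  then show ?thesis by (rule finite_subset) (intro finite_imageI finite_PiE, auto)
qed

locale convex_body = monomial_ordering r for r :: "'n::finite exponent rel" +
  fixes P :: "(real ^ 'n) set"
  assumes bounded_P: "bounded P" and convex_P: "convex P" and measure_P: "measure lebesgue P > 0"
begin

definition lattice_points :: "real \<Rightarrow> (real ^ 'n) set" where
  "lattice_points s = (*\<^sub>R) s ` P \<inter> int_lattice"

lemma coord_bound_P: obtains K :: nat where "\<And>x i. x \<in> P \<Longrightarrow> \<bar>x $ i\<bar> \<le> real K"
proof -
  obtain B where B: "\<And>x. x \<in> P \<Longrightarrow> norm x \<le> B" using bounded_P by (auto simp: bounded_iff)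
  obtain K :: nat where K: "B \<le> real K" using real_arch_simple by blast
  have "\<bar>x $ i\<bar> \<le> real K" if "x \<in> P" for x i
    using component_le_norm_cart[of x i] B[OF that] K by linarith
  then show ?thesis by (rule that)
qed

lemma coord_bound_lattice_points:
  obtains K :: nat
  where "\<And>s x i. s \<ge> 0 \<Longrightarrow> x \<in> lattice_points s \<Longrightarrow> \<bar>x $ i\<bar> \<le> s * real K"
proof -
  obtain K :: nat where K: "\<And>x i. x \<in> P \<Longrightarrow> \<bar>x $ i\<bar> \<le> real K" by (rule coord_bound_P) blast
  have "\<bar>x $ i\<bar> \<le> s * real K" if "s \<ge> 0" "x \<in> lattice_points s" for s x i
  proof -
    obtain y where "y \<in> P" "x = s *\<^sub>R y" using \<open>x \<in> lattice_points s\<close> by (auto simp: lattice_points_def)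
    then show ?thesis using K[of y i] that(1) by (simp add: abs_mult mult_left_mono)
  qed
  then show ?thesis using that by blast
qed

lemma finite_lattice_points: "s \<ge> 0 \<Longrightarrow> finite (lattice_points s)"
proof -
  assume s: "s \<ge> 0"
  obtain K :: nat where K: "\<And>s x i. s \<ge> 0 \<Longrightarrow> x \<in> lattice_points s \<Longrightarrow> \<bar>x $ i\<bar> \<le> s * real K"
    by (rule coord_bound_lattice_points) blast
  obtain L :: nat where "s * real K \<le> real L" using real_arch_simple by blast
  then have "\<bar>x $ i\<bar> \<le> real L" if "x \<in> lattice_points s" for x i
    using K[OF s that] order_trans by blast
  then show ?thesis
    by (intro finite_int_lattice_bounded[of _ L]) (simp_all add: lattice_points_def)
qed

text \<open>Convexity with weights \<open>s / (s + t)\<close> and \<open>t / (s + t)\<close> places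
  the sum of the dilates by \<open>s\<close> and \<open>t\<close> in the dilate by
  \<open>s + t\<close>; if both factors are 0, everything is the origin.\<close>

lemma lattice_points_add:
  assumes "s \<ge> 0" "t \<ge> 0" "a \<in> lattice_points s" "b \<in> lattice_points t"
  shows "a + b \<in> lattice_points (s + t)"
proof -
  obtain x y where xy: "x \<in> P" "y \<in> P" "a = s *\<^sub>R x" "b = t *\<^sub>R y"
    using assms by (auto simp: lattice_points_def)
  have "a + b \<in> int_lattice" using assms by (auto simp: lattice_points_def int_lattice_def)
  moreover have "a + b \<in> (*\<^sub>R) (s + t) ` P"
  proof (cases "s + t = 0")
    case True
    then have "s = 0" "t = 0" using assms(1,2) by auto
    then show ?thesis using xy by force
  next
    case False
    then have "(s / (s + t)) *\<^sub>R x + (t / (s + t)) *\<^sub>R y \<in> P"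
      using assms(1,2) xy by (intro convexD[OF convex_P]) (auto simp: add_divide_distrib[symmetric])
    moreover have "a + b = (s + t) *\<^sub>R ((s / (s + t)) *\<^sub>R x + (t / (s + t)) *\<^sub>R y)"
      using False by (simp add: xy scaleR_add_right)
    ultimately show ?thesis by blast
  qed
  ultimately show ?thesis by (simp add: lattice_points_def)
qed

lemma std_exps_lattice_points_add:
  assumes "s \<ge> 0" "t \<ge> 0" "e \<in> std_exps r (lattice_points s)" "f \<in> std_exps r (lattice_points t)"
  shows "e + f \<in> std_exps r (lattice_points (s + t))"
  using assms finite_lattice_points by (intro std_exps_add[OF _ _ assms(3,4)] lattice_points_add) auto

lemma std_exps_lattice_points_mult:
  assumes "s \<ge> 0" "e \<in> std_exps r (lattice_points s)"
  shows "(\<chi> i. k * e $ i) \<in> std_exps r (lattice_points (real k * s))"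
proof (induction k)
  case 0
  \<comment> \<open>The zeroth multiple needs the dilate by 0 to be the origin and not empty. It
    does occur, for instance as \<open>m = 0\<close> in the lower inclusion when \<epsilon> =
    1.\<close>
  have "P \<noteq> {}" using measure_P by auto
  then have "(0::real ^ 'n) \<in> lattice_points 0" by (auto simp: lattice_points_def int_lattice_def)
  then have "(\<chi> i. 0) \<in> std_exps r (lattice_points 0)"
    using zero_in_std_exps unfolding zero_vec_def by blast
  then show ?case by simp
next
  case (Suc k)
  have "(\<chi> i. Suc k * e $ i) = e + (\<chi> i. k * e $ i)" by (simp add: vec_eq_iff)
  then show ?case
    using std_exps_lattice_points_add[OF assms(1) _ assms(2) Suc] assms(1) by (simp add: algebra_simps)
qed

text \<open>A convex set of positive volume has an interior point, hence contains a cube; its dilate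
  by \<open>s\<close> contains an integer box of side about \<open>s * \<delta>\<close>.\<close>

lemma large_cube_in_std_exps:
  obtains c s0 where "c > 0" "s0 > 0"
    and "\<And>s. s \<ge> s0 \<Longrightarrow> \<exists>M::nat. real M \<ge> c * s \<and> (\<chi> i. M) \<in> std_exps r (lattice_points s)"
proof -
  have "interior P \<noteq> {}"
    using measure_P negligible_convex_interior[OF convex_P] negligible_imp_measure0 by force
  then obtain p where "p \<in> interior P" by blast
  then obtain \<rho> where \<rho>: "\<rho> > 0" "cball p \<rho> \<subseteq> P" by (meson mem_interior_cball)
  \<comment> \<open>By the \<open>l1\<close> bound on the norm, the cube of half-side \<delta> about
    \<open>p\<close> fits into the ball of radius \<rho>.\<close>
  define \<delta> where "\<delta> = \<rho> / real CARD('n)"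
  have \<delta>: "\<delta> > 0" using \<rho> by (simp add: \<delta>_def)
  have box: "x \<in> P" if "\<And>i. \<bar>x $ i - p $ i\<bar> \<le> \<delta>" for x
  proof -
    have "norm (x - p) \<le> (\<Sum>i\<in>UNIV. \<bar>(x - p) $ i\<bar>)" by (rule norm_le_l1_cart)
    also have "\<dots> \<le> (\<Sum>i\<in>(UNIV::'n set). \<delta>)" using that by (intro sum_mono) simp
    also have "\<dots> = \<rho>" by (simp add: \<delta>_def)
    finally show ?thesis using \<rho>(2) by (auto simp: dist_norm norm_minus_commute)
  qed
  have "\<exists>M::nat. real M \<ge> \<delta> / 2 * s \<and> (\<chi> i. M) \<in> std_exps r (lattice_points s)"
    if s: "s \<ge> 2 / \<delta>" for s
  proof -
    \<comment> \<open>Room for two roundings: moving \<open>s * p\<close> down to the lattice point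
      \<open>v\<close> costs at most 1 per coordinate, and \<open>M\<close>, the floor of
      \<open>s * \<delta>\<close>, is still at least half of it.\<close>
    have s\<delta>: "s * \<delta> \<ge> 2" using s \<delta> by (simp add: field_simps)
    have s0: "s > 0" using s \<delta> by (smt (verit) divide_pos_pos)
    define M where "M = nat \<lfloor>s * \<delta>\<rfloor>"
    have M: "real M \<le> s * \<delta>" "s * \<delta> - 1 \<le> real M" unfolding M_def using s\<delta> by linarith+
    define v :: "real ^ 'n" where "v = (\<chi> i. of_int \<lfloor>s * p $ i\<rfloor>)"
    have "(\<chi> i. M) \<in> std_exps r (lattice_points s)"
    proof (rule exponent_in_std_exps_of_box[where v = v])
      show "finite (lattice_points s)" using s0 by (intro finite_lattice_points) simp
      fix f :: "'n exponent" assume f: "\<And>i. f $ i \<le> (\<chi> i. M) $ i"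
      let ?x = "v + real_vec f"
      have "\<bar>?x $ i - s * p $ i\<bar> \<le> s * \<delta>" for i
      proof -
        have "real (f $ i) \<le> real M" using f[of i] by simp
        then show ?thesis unfolding v_def using M(1) s\<delta> by simp linarith
      qed
      then have "\<bar>(?x /\<^sub>R s) $ i - p $ i\<bar> \<le> \<delta>" for i
      proof -
        have "(?x /\<^sub>R s) $ i - p $ i = (?x $ i - s * p $ i) / s"
          using s0 by (simp add: field_simps)
        then show ?thesis using \<open>\<bar>?x $ i - s * p $ i\<bar> \<le> s * \<delta>\<close> s0
          by (simp add: abs_divide field_simps)
      qed
      then have "?x /\<^sub>R s \<in> P" by (rule box)
      moreover have "?x = s *\<^sub>R (?x /\<^sub>R s)" using s0 by simp
      ultimately have "?x \<in> (*\<^sub>R) s ` P" by blast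
      then show "?x \<in> lattice_points s"
        by (auto simp: lattice_points_def int_lattice_def v_def)
    qed
    moreover have "real M \<ge> \<delta> / 2 * s" using M(2) s\<delta> by (simp add: field_simps)
    ultimately show ?thesis by blast
  qed
  with \<delta> show ?thesis using that[of "\<delta> / 2" "2 / \<delta>"] by simp
qed

section \<open>Compactness of the limit shape\<close>

lemma limit_shape_eq:
  "limit_shape r P = closure (\<Union>k::nat. (*\<^sub>R) (1 / 2 ^ k) ` real_vec ` std_exps r (lattice_points (2 ^ k)))"
  by (simp add: limit_shape_def lattice_points_def nonleading_exponents_eq)

text \<open>In the dilate by \<open>2^k\<close> each coordinate takes at most
  \<open>2 * 2^k * K + 1\<close> integer values, so standard exponents have coordinates at most
  \<open>2 * 2^k * K\<close>. After rescaling the bound \<open>2 * K\<close> is independent of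
  \<open>k\<close>.\<close>

lemma compact_limit_shape: "compact (limit_shape r P)"
proof -
  obtain K :: nat where K: "\<And>s x i. s \<ge> 0 \<Longrightarrow> x \<in> lattice_points s \<Longrightarrow> \<bar>x $ i\<bar> \<le> s * real K"
    by (rule coord_bound_lattice_points) blast
  let ?B = "{x::real ^ 'n. \<forall>i. \<bar>x $ i\<bar> \<le> 2 * real K}"
  have "(1 / 2 ^ k) *\<^sub>R real_vec e \<in> ?B" if e: "e \<in> std_exps r (lattice_points (2 ^ k))" for k e
  proof -
    have "e $ i \<le> 2 * 2 ^ k * K" for i
    proof -
      let ?T = "of_int ` {- int (2 ^ k * K)..int (2 ^ k * K)} :: real set"
      have "a $ i \<in> ?T" if "a \<in> lattice_points (2 ^ k)" for a
        by (rule int_lattice_coord_bound[where A = "lattice_points (2 ^ k)"])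
          (use that K[of "2 ^ k"] in \<open>auto simp: lattice_points_def\<close>)
      then have "e $ i < card ?T"
        using e finite_lattice_points by (intro std_exps_bounded_by_values[of "lattice_points (2 ^ k)"]) auto
      also have "card ?T \<le> card {- int (2 ^ k * K)..int (2 ^ k * K)}" by (rule card_image_le) simp
      also have "\<dots> = 2 * 2 ^ k * K + 1" by (simp add: nat_eq_iff)
      finally show ?thesis by simp
    qed
    then have "real (e $ i) \<le> real (2 * 2 ^ k * K)" for i by (simp only: of_nat_le_iff)
    then show ?thesis by (simp add: field_simps)
  qed
  then have "(\<Union>k::nat. (*\<^sub>R) (1 / 2 ^ k) ` real_vec ` std_exps r (lattice_points (2 ^ k))) \<subseteq> ?B"
    by blast
  moreover have "bounded ?B"
    unfolding bounded_iff
  proof (intro exI ballI)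
    fix x assume x: "x \<in> ?B"
    have "norm x \<le> (\<Sum>i\<in>UNIV. \<bar>x $ i\<bar>)" by (rule norm_le_l1_cart)
    also have "\<dots> \<le> (\<Sum>i\<in>(UNIV::'n set). 2 * real K)" using x by (intro sum_mono) simp
    finally show "norm x \<le> (\<Sum>i\<in>(UNIV::'n set). 2 * real K)" .
  qed
  ultimately show ?thesis
    unfolding limit_shape_eq compact_eq_bounded_closed using bounded_subset by blast
qed

section \<open>The upper inclusion\<close>

lemma std_exps_subset_limit_shape:
  assumes d: "d > 0" and e: "e \<in> std_exps r (lattice_points d)"
  shows "real_vec e /\<^sub>R d \<in> limit_shape r P"
proof -
  obtain c s0 where cs: "c > 0" "s0 > 0"
    and cube: "\<And>s. s \<ge> s0 \<Longrightarrow> \<exists>M::nat. real M \<ge> c * s \<and> (\<chi> i. M) \<in> std_exps r (lattice_points s)"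
    by (rule large_cube_in_std_exps) blast
  \<comment> \<open>Once \<open>2^k \<ge> s0\<close>, this is the largest number of copies of the
    dilate by \<open>d\<close> that leaves a remainder of at least \<open>s0\<close> inside the
    dilate by \<open>2^k\<close>.\<close>
  define j where "j k = nat \<lfloor>(2 ^ k - s0) / d\<rfloor>" for k :: nat
  have ev: "\<forall>\<^sub>F k in sequentially. (2::real) ^ k \<ge> s0"
    using filterlim_realpow_sequentially_gt1[of "2::real"] by (auto simp: filterlim_at_infinity_conv_norm_at_top filterlim_at_top norm_power)
  have jle: "real (j k) \<le> (2 ^ k - s0) / d" and jge: "real (j k) \<ge> (2 ^ k - s0) / d - 1"
    if "2 ^ k \<ge> s0" for k
  proof -
    have "(2 ^ k - s0) / d \<ge> 0" using that d by simp
    then show "real (j k) \<le> (2 ^ k - s0) / d" "real (j k) \<ge> (2 ^ k - s0) / d - 1"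
      unfolding j_def by linarith+
  qed
  have mem: "(real (j k) / 2 ^ k) *\<^sub>R real_vec e \<in> limit_shape r P" if k: "2 ^ k \<ge> s0" for k
  proof -
    define s where "s = 2 ^ k - real (j k) * d"
    have "s \<ge> s0" using jle[OF k] d by (simp add: s_def field_simps)
    \<comment> \<open>The cube only guarantees some exponent for the remainder; downward closure
      then discards it and leaves \<open>j k\<close> times \<open>e\<close>.\<close>
    then obtain M where M: "(\<chi> i. M) \<in> std_exps r (lattice_points s)" using cube by blast
    have "(\<chi> i. j k * e $ i) + (\<chi> i. M) \<in> std_exps r (lattice_points (real (j k) * d + s))"
      using d cs \<open>s \<ge> s0\<close>
      by (intro std_exps_lattice_points_add[OF _ _ std_exps_lattice_points_mult[OF _ e] M]) auto
    then have "(\<chi> i. j k * e $ i) + (\<chi> i. M) \<in> std_exps r (lattice_points (2 ^ k))"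
      by (simp add: s_def)
    then have "(\<chi> i. j k * e $ i) \<in> std_exps r (lattice_points (2 ^ k))"
      by (rule std_exps_downward[rotated]) (auto intro: finite_lattice_points)
    moreover have "(real (j k) / 2 ^ k) *\<^sub>R real_vec e = (1 / 2 ^ k) *\<^sub>R real_vec (\<chi> i. j k * e $ i)"
      by (simp add: vec_eq_iff)
    ultimately show ?thesis
      unfolding limit_shape_eq by (intro subsetD[OF closure_subset]) blast
  qed
  have "(\<lambda>k. real (j k) / 2 ^ k) \<longlonglongrightarrow> 1 / d"
  proof (rule tendsto_sandwich)
    show "\<forall>\<^sub>F k in sequentially. ((2 ^ k - s0) / d - 1) / 2 ^ k \<le> real (j k) / 2 ^ k"
      using ev by eventually_elim (intro divide_right_mono jge, auto)
    show "\<forall>\<^sub>F k in sequentially. real (j k) / 2 ^ k \<le> ((2 ^ k - s0) / d) / 2 ^ k"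
      using ev by eventually_elim (intro divide_right_mono jle, auto)
    have z: "(\<lambda>k::nat. x / 2 ^ k) \<longlonglongrightarrow> 0" for x :: real
      by (rule LIMSEQ_divide_realpow_zero) simp
    have "(\<lambda>k::nat. 1 / d - (s0 / d + 1) / 2 ^ k) \<longlonglongrightarrow> 1 / d - 0" by (intro tendsto_intros z)
    then show "(\<lambda>k::nat. ((2 ^ k - s0) / d - 1) / 2 ^ k) \<longlonglongrightarrow> 1 / d"
      using d by (simp add: field_simps)
    have "(\<lambda>k::nat. 1 / d - (s0 / d) / 2 ^ k) \<longlonglongrightarrow> 1 / d - 0" by (intro tendsto_intros z)
    then show "(\<lambda>k::nat. ((2 ^ k - s0) / d) / 2 ^ k) \<longlonglongrightarrow> 1 / d"
      using d by (simp add: field_simps)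
  qed
  then have "(\<lambda>k. (real (j k) / 2 ^ k) *\<^sub>R real_vec e) \<longlonglongrightarrow> (1 / d) *\<^sub>R real_vec e"
    by (rule tendsto_scaleR) (rule tendsto_const)
  moreover have "closed (limit_shape r P)" by (simp add: limit_shape_def)
  ultimately have "(1 / d) *\<^sub>R real_vec e \<in> limit_shape r P"
    using ev mem by (intro Lim_in_closed_set) (auto elim: eventually_mono)
  then show ?thesis by (simp add: inverse_eq_divide)
qed

section \<open>The lower inclusion\<close>

text \<open>The stages \<open>U k\<close> ascend, because doubling an exponent doubles the dilate.
  Their open \<eta>-neighbourhoods cover the compact limit shape, so the largest index in a finite
  subcover serves all points at once.\<close>

lemma limit_shape_net:
  assumes "\<eta> > 0"
  obtains k :: nat where "\<And>x. x \<in> limit_shape r P \<Longrightarrow>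
    \<exists>f\<in>std_exps r (lattice_points (2 ^ k)). dist x ((1 / 2 ^ k) *\<^sub>R real_vec f) < \<eta>"
proof -
  define U where "U k = (*\<^sub>R) (1 / 2 ^ k) ` real_vec ` std_exps r (lattice_points (2 ^ k))" for k :: nat
  have "U k \<subseteq> U (Suc k)" for k
  proof
    fix x assume "x \<in> U k"
    then obtain f where f: "f \<in> std_exps r (lattice_points (2 ^ k))"
      "x = (1 / 2 ^ k) *\<^sub>R real_vec f" by (auto simp: U_def)
    have "(\<chi> i. 2 * f $ i) \<in> std_exps r (lattice_points (2 ^ Suc k))"
      using std_exps_lattice_points_mult[OF _ f(1), of 2] by simp
    moreover have "x = (1 / 2 ^ Suc k) *\<^sub>R real_vec (\<chi> i. 2 * f $ i)"
      by (simp add: f(2) vec_eq_iff)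
    ultimately show "x \<in> U (Suc k)" unfolding U_def by blast
  qed
  then have mono: "k \<le> l \<Longrightarrow> U k \<subseteq> U l" for k l by (rule lift_Suc_mono_le)
  define V where "V k = (\<Union>w\<in>U k. ball w \<eta>)" for k
  have "limit_shape r P \<subseteq> (\<Union>k. V k)"
  proof
    fix x assume "x \<in> limit_shape r P"
    then have "x \<in> closure (\<Union>k. U k)" by (simp add: limit_shape_eq U_def)
    then obtain w where "w \<in> (\<Union>k. U k)" "dist w x < \<eta>"
      using assms closure_approachable by metis
    then show "x \<in> (\<Union>k. V k)" by (auto simp: V_def)
  qed
  moreover have "open (V k)" for k by (auto simp: V_def)
  ultimately obtain C where C: "finite C" "limit_shape r P \<subseteq> (\<Union>k\<in>C. V k)"
    using compactE_image[OF compact_limit_shape, of UNIV V] by metis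
  \<comment> \<open>Inserting 0 keeps \<open>Max\<close> meaningful when the subcover is
    empty.\<close>
  define k where "k = Max (insert 0 C)"
  have "\<exists>f\<in>std_exps r (lattice_points (2 ^ k)). dist x ((1 / 2 ^ k) *\<^sub>R real_vec f) < \<eta>"
    if "x \<in> limit_shape r P" for x
  proof -
    obtain l w where l: "l \<in> C" "w \<in> U l" "dist w x < \<eta>"
      using \<open>x \<in> limit_shape r P\<close> C(2) unfolding V_def by auto
    have "l \<le> k" using l(1) C(1) by (simp add: k_def)
    then have "w \<in> U k" using mono l(2) by blast
    then show ?thesis using l(3) by (auto simp: U_def dist_commute)
  qed
  then show ?thesis using that by blast
qed

text \<open>If \<open>x\<close> is \<eta>-close to \<open>f / 2^k\<close>, then \<open>m * f\<close>
  with \<open>m * 2^k\<close> about \<open>(1 - \<epsilon>) * d\<close> approximates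
  \<open>e\<close>, and the cube exponent of the remaining dilate covers the deficit in every
  coordinate.\<close>

lemma limit_shape_shrunk_subset:
  assumes \<epsilon>: "0 < \<epsilon>" "\<epsilon> \<le> 1"
  obtains D where "D > 0"
    and "\<And>d e x. d > D \<Longrightarrow> x \<in> limit_shape r P \<Longrightarrow> real_vec e = ((1 - \<epsilon>) * d) *\<^sub>R x
      \<Longrightarrow> e \<in> std_exps r (lattice_points d)"
proof -
  obtain c s0 where cs: "c > 0" "s0 > 0"
    and cube: "\<And>s. s \<ge> s0 \<Longrightarrow> \<exists>M::nat. real M \<ge> c * s \<and> (\<chi> i. M) \<in> std_exps r (lattice_points s)"
    by (rule large_cube_in_std_exps) blast
  \<comment> \<open>Chosen so that the total error \<open>d * \<eta>\<close> equals
    \<open>c * (\<epsilon> * d / 2)\<close>, the size guaranteed for a cube in a remainder of at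
    least \<open>\<epsilon> * d / 2\<close>.\<close>
  define \<eta> where "\<eta> = c * \<epsilon> / 2"
  have \<eta>: "\<eta> > 0" using cs \<epsilon> by (simp add: \<eta>_def)
  obtain k :: nat where net: "\<And>x. x \<in> limit_shape r P \<Longrightarrow>
    \<exists>f\<in>std_exps r (lattice_points (2 ^ k)). dist x ((1 / 2 ^ k) *\<^sub>R real_vec f) < \<eta>"
    by (rule limit_shape_net[OF \<eta>]) blast
  \<comment> \<open>For \<open>d > D\<close> the remainder, at least
    \<open>\<epsilon> * d - 2^k\<close>, exceeds both \<open>\<epsilon> * d / 2\<close> and
    \<open>s0\<close>. As \<open>k\<close> was fixed before \<open>x\<close>, the bound is
    uniform.\<close>
  define D where "D = 2 * (2 ^ k + s0) / \<epsilon>"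
  have "e \<in> std_exps r (lattice_points d)"
    if d: "d > D" and x: "x \<in> limit_shape r P" and e: "real_vec e = ((1 - \<epsilon>) * d) *\<^sub>R x" for d e x
  proof -
    have \<epsilon>d: "\<epsilon> * d > 2 * (2 ^ k + s0)" using d \<epsilon> by (simp add: D_def field_simps)
    have D0: "D > 0" using cs \<epsilon> by (simp add: D_def add_pos_pos)
    then have d0: "d > 0" using d by linarith
    obtain f where f: "f \<in> std_exps r (lattice_points (2 ^ k))"
      "dist x ((1 / 2 ^ k) *\<^sub>R real_vec f) < \<eta>" using net x by blast
    \<comment> \<open>Rounding up makes \<open>m * 2^k\<close> dominate
      \<open>(1 - \<epsilon>) * d\<close>, at the price of at most \<open>2^k\<close> from the
      remainder.\<close>
    define m where "m = nat \<lceil>(1 - \<epsilon>) * d / 2 ^ k\<rceil>"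
    have nn: "(1 - \<epsilon>) * d / 2 ^ k \<ge> 0" using \<epsilon> d0 by simp
    then have "real m \<ge> (1 - \<epsilon>) * d / 2 ^ k" "real m \<le> (1 - \<epsilon>) * d / 2 ^ k + 1"
      unfolding m_def by linarith+
    then have m: "real m * 2 ^ k \<ge> (1 - \<epsilon>) * d" "real m * 2 ^ k \<le> (1 - \<epsilon>) * d + 2 ^ k"
      by (simp_all add: field_simps)
    define s where "s = d - real m * 2 ^ k"
    have "s \<ge> \<epsilon> * d - 2 ^ k" using m(2) by (simp add: s_def algebra_simps)
    moreover have "(2::real) ^ k > 0" by simp
    ultimately have s: "s \<ge> \<epsilon> * d / 2" "s \<ge> s0" using \<epsilon>d cs by argo+
    obtain M :: nat where M: "real M \<ge> c * s" "(\<chi> i. M) \<in> std_exps r (lattice_points s)"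
      using cube[OF s(2)] by blast
    have "(\<chi> i. m * f $ i) + (\<chi> i. M) \<in> std_exps r (lattice_points (real m * 2 ^ k + s))"
      using cs s by (intro std_exps_lattice_points_add[OF _ _ std_exps_lattice_points_mult[OF _ f(1)] M(2)]) auto
    then have "(\<chi> i. m * f $ i) + (\<chi> i. M) \<in> std_exps r (lattice_points d)"
      by (simp add: s_def)
    then show ?thesis
    proof (rule std_exps_downward[rotated])
      show "finite (lattice_points d)" using d0 by (intro finite_lattice_points) simp
      fix i
      let ?w = "real (f $ i) / 2 ^ k"
      have "\<bar>x $ i - ?w\<bar> \<le> dist x ((1 / 2 ^ k) *\<^sub>R real_vec f)"
        using component_le_norm_cart[of "x - (1 / 2 ^ k) *\<^sub>R real_vec f" i] by (simp add: dist_norm)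
      then have xi: "x $ i \<le> ?w + \<eta>" using f(2) by linarith
      have "real (e $ i) = (1 - \<epsilon>) * d * x $ i" using arg_cong[OF e, of "\<lambda>v. v $ i"] by simp
      also have "\<dots> \<le> (1 - \<epsilon>) * d * (?w + \<eta>)" using \<epsilon> d0 xi by (intro mult_left_mono) auto
      also have "\<dots> = (1 - \<epsilon>) * d * ?w + (1 - \<epsilon>) * d * \<eta>" by (simp add: algebra_simps)
      also have "\<dots> \<le> real m * 2 ^ k * ?w + d * \<eta>"
        using m(1) \<epsilon> d0 \<eta> by (intro add_mono mult_right_mono) auto
      also have "d * \<eta> = c * (\<epsilon> * d / 2)" by (simp add: \<eta>_def)
      also have "\<dots> \<le> c * s" using s(1) cs by (intro mult_left_mono) auto
      also have "\<dots> \<le> real M" by (rule M(1))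
      also have "real m * 2 ^ k * ?w = real m * real (f $ i)" by simp
      finally have "real (e $ i) \<le> real (m * f $ i + M)" by simp
      then show "e $ i \<le> ((\<chi> i. m * f $ i) + (\<chi> i. M)) $ i" by (simp only: of_nat_le_iff) simp
    qed
  qed
  moreover have "D > 0" using cs \<epsilon> by (simp add: D_def add_pos_pos)
  ultimately show ?thesis using that by blast
qed

end

section \<open>Both inclusions as sets of real vectors\<close>

lemma real_vec_in_nat_lattice: "real_vec e \<in> nat_lattice"
  by (simp add: nat_lattice_def)

lemma nat_lattice_cases:
  assumes "x \<in> nat_lattice" obtains e where "x = real_vec e"
proof -
  have "\<forall>i. \<exists>n. x $ i = real n" using assms by (auto simp: nat_lattice_def elim: Nats_cases)
  then obtain e where "\<And>i. x $ i = real (e i)" by metis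
  then have "x = real_vec (\<chi> i. e i)" by (simp add: vec_eq_iff)
  then show ?thesis using that by blast
qed

theorem theorem9:
  fixes r :: "'n::finite exponent rel" and P :: "(real ^ 'n) set" and \<epsilon> :: real
  assumes "monomial_order r"
    and "bounded P" and "convex P" and "measure lebesgue P > 0"
    and "0 < \<epsilon>" and "\<epsilon> \<le> 1"
  shows "\<exists>D>0. \<forall>d::real. d > D \<longrightarrow>
    (*\<^sub>R) ((1 - \<epsilon>) * d) ` limit_shape r P \<inter> nat_lattice
      \<subseteq> nonleading_exponents r ((*\<^sub>R) d ` P \<inter> int_lattice) \<and>
    nonleading_exponents r ((*\<^sub>R) d ` P \<inter> int_lattice)
      \<subseteq> (*\<^sub>R) d ` limit_shape r P \<inter> nat_lattice"
proof -
  interpret convex_body r P by standard (use assms in auto)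
  obtain D where D: "D > 0"
    "\<And>d e x. d > D \<Longrightarrow> x \<in> limit_shape r P \<Longrightarrow> real_vec e = ((1 - \<epsilon>) * d) *\<^sub>R x
      \<Longrightarrow> e \<in> std_exps r (lattice_points d)"
    by (rule limit_shape_shrunk_subset[OF assms(5,6)]) blast
  have "(*\<^sub>R) ((1 - \<epsilon>) * d) ` limit_shape r P \<inter> nat_lattice \<subseteq> real_vec ` std_exps r (lattice_points d)"
    if "d > D" for d
  proof
    fix y assume y: "y \<in> (*\<^sub>R) ((1 - \<epsilon>) * d) ` limit_shape r P \<inter> nat_lattice"
    then obtain e where "y = real_vec e" using nat_lattice_cases by blast
    then show "y \<in> real_vec ` std_exps r (lattice_points d)" using D(2)[OF that] y by auto
  qed
  moreover have "real_vec ` std_exps r (lattice_points d) \<subseteq> (*\<^sub>R) d ` limit_shape r P \<inter> nat_lattice"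
    if "d > D" for d
  proof -
    have d: "d > 0" using that D(1) by linarith
    have "real_vec e \<in> (*\<^sub>R) d ` limit_shape r P" if "e \<in> std_exps r (lattice_points d)" for e
      using std_exps_subset_limit_shape[OF d that] d by (intro image_eqI[of _ _ "real_vec e /\<^sub>R d"]) auto
    then show ?thesis using real_vec_in_nat_lattice by blast
  qed
  ultimately show ?thesis
    using D(1) unfolding nonleading_exponents_eq lattice_points_def by blast
qed

end
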